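(* Let $F:\mathbb{R}^n\to\mathbb{R}^m$ be continuous, let $\delta\ge 0$, and let $C\in\mathbb{R}^{m\times r}$ with $r\le m$ have full column rank. Suppose that the QR factorization of $C$ is $C=QR$, where $Q\in\mathbb{R}^{m\times r}$ has orthonormal columns and $R\in\mathbb{R}^{r\times r}$ is diagonal with positive diagonal entries. Let $\Omega=\{y\in\mathbb{R}^r:\|y\|_\infty\le\delta\}$. Then for every $x\in\mathbb{R}^n$, $$\max_{y\in\Omega}\|F(x)-Cy\|^2=\|F(x)\|^2+2\delta\,\|C^\top F(x)\|_1+\|C\|_F^2\,\delta^2 .$$
   Context: $\|\cdot\|$ is the Euclidean norm, $\|\cdot\|_1$ the vector $\ell_1$ norm, $\|\cdot\|_\infty$ the vector max norm, and $\|C\|_F=\big(\sum_{i,j}C_{ij}^2\big)^{1/2}$ the Frobenius norm. *)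

theory Defs
  imports "HOL-Analysis.Analysis"
begin

definition l1_norm :: "real ^ 'n \<Rightarrow> real" where
  "l1_norm v = (\<Sum>i\<in>UNIV. \<bar>v $ i\<bar>)"

definition frobenius_norm :: "real ^ 'n ^ 'm \<Rightarrow> real" where
  "frobenius_norm A = sqrt (\<Sum>i\<in>UNIV. \<Sum>j\<in>UNIV. (A $ i $ j)\<^sup>2)"

definition orthonormal_columns :: "real ^ 'n ^ 'm \<Rightarrow> bool" where
  "orthonormal_columns Q \<longleftrightarrow>
     (\<forall>i. norm (column i Q) = 1) \<and>
     (\<forall>i j. i \<noteq> j \<longrightarrow> orthogonal (column i Q) (column j Q))"

definition diagonal_matrix :: "real ^ 'n ^ 'n \<Rightarrow> bool" where
  "diagonal_matrix A \<longleftrightarrow> (\<forall>i j. i \<noteq> j \<longrightarrow> A $ i $ j = 0)"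

definition is_maximum_on :: "('a \<Rightarrow> real) \<Rightarrow> 'a set \<Rightarrow> real \<Rightarrow> bool" where
  "is_maximum_on f S M \<longleftrightarrow> (\<exists>y\<in>S. f y = M) \<and> (\<forall>y\<in>S. f y \<le> M)"

end

theory Submission
  imports Defs
begin

text \<open>
  Since \<^term>\<open>R\<close> is diagonal, the columns of \<^term>\<open>C = Q ** R\<close> are multiples of those of
  \<^term>\<open>Q\<close>, hence pairwise orthogonal. By Pythagoras the cross terms of the quadratic form
  vanish, and the squared residual splits into one-variable functions
  (\<open>norm_residual_squared_separable\<close>):
  \[ \|f - C y\|^2 = \|f\|^2 + \sum_j \left(\|c_j\|^2 y_j^2 - 2\, (C^T f)_j\, y_j\right). \]
  The max-norm ball is a product of intervals, so each coordinate can be maximised on its own.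
  Each summand is a convex parabola, hence largest at an endpoint \<open>y_j = \<plusminus> \<delta>\<close>, and the better
  endpoint is the one whose sign is opposite to that of \<open>(C^T f)_j\<close>; there the summand equals
  \<open>\<parallel>c_j\<parallel>^2 \<delta>^2 + 2 \<delta> \<bar>(C^T f)_j\<bar>\<close>. Summing the squared column norms gives the squared
  Frobenius norm and summing the absolute values gives the \<open>l1\<close> norm.
\<close>

lemma infnorm_le_iff_components:
  fixes y :: "real ^ 'n"
  shows "infnorm y \<le> d \<longleftrightarrow> (\<forall>i. \<bar>y $ i\<bar> \<le> d)"
proof
  assume "infnorm y \<le> d"
  then show "\<forall>i. \<bar>y $ i\<bar> \<le> d"
    using component_le_infnorm_cart[of y] order_trans by blast
next
  assume "\<forall>i. \<bar>y $ i\<bar> \<le> d"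
  then show "infnorm y \<le> d"
    unfolding infnorm_cart by (intro cSup_least) auto
qed

lemma column_mult_diagonal:
  assumes "diagonal_matrix R"
  shows "column j (Q ** R) = (R $ j $ j) *\<^sub>R column j Q"
proof -
  have "(\<Sum>k\<in>UNIV. Q $ i $ k * R $ k $ j) = Q $ i $ j * R $ j $ j" for i
  proof -
    have "(\<Sum>k\<in>UNIV. Q $ i $ k * R $ k $ j) =
        (\<Sum>k\<in>UNIV. if k = j then Q $ i $ j * R $ j $ j else 0)"
      using assms by (intro sum.cong) (auto simp: diagonal_matrix_def)
    then show ?thesis by simp
  qed
  then show ?thesis
    by (simp add: vec_eq_iff column_def matrix_matrix_mult_def mult.commute)
qed

lemma orthogonal_columns_mult_diagonal:
  assumes "orthonormal_columns Q" and "diagonal_matrix R" and "i \<noteq> j"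
  shows "orthogonal (column i (Q ** R)) (column j (Q ** R))"
  using assms by (simp add: column_mult_diagonal orthonormal_columns_def orthogonal_def)

lemma frobenius_norm_squared_columns:
  "(frobenius_norm C)\<^sup>2 = (\<Sum>j\<in>UNIV. (norm (column j C))\<^sup>2)"
proof -
  have "(frobenius_norm C)\<^sup>2 = (\<Sum>i\<in>UNIV. \<Sum>j\<in>UNIV. (C $ i $ j)\<^sup>2)"
    unfolding frobenius_norm_def by (simp add: sum_nonneg)
  also have "\<dots> = (\<Sum>j\<in>UNIV. \<Sum>i\<in>UNIV. (C $ i $ j)\<^sup>2)"
    by (rule sum.swap)
  also have "\<dots> = (\<Sum>j\<in>UNIV. (norm (column j C))\<^sup>2)"
    unfolding power2_norm_eq_inner by (simp add: inner_vec_def column_def power2_eq_square)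
  finally show ?thesis .
qed

text \<open>
  Orthogonality of the columns diagonalises the quadratic form \<open>y \<mapsto> \<parallel>C y\<parallel>^2\<close>, so that the
  residual decouples into the coordinates of \<^term>\<open>y\<close>.
\<close>

lemma norm_residual_squared_separable:
  fixes C :: "real ^ 'r ^ 'm" and f :: "real ^ 'm"
  assumes "\<And>i j. i \<noteq> j \<Longrightarrow> orthogonal (column i C) (column j C)"
  shows "(norm (f - C *v y))\<^sup>2 =
           (norm f)\<^sup>2 + (\<Sum>j\<in>UNIV. (norm (column j C))\<^sup>2 * (y $ j)\<^sup>2
                               - 2 * (transpose C *v f) $ j * y $ j)"
proof -
  have Cy: "C *v y = (\<Sum>j\<in>UNIV. y $ j *\<^sub>R column j C)"
    by (simp add: matrix_mult_sum scalar_mult_eq_scaleR)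
  have "(norm (C *v y))\<^sup>2 = (\<Sum>j\<in>UNIV. (norm (y $ j *\<^sub>R column j C))\<^sup>2)"
    unfolding Cy using assms
    by (intro norm_sum_Pythagorean) (auto simp: pairwise_def orthogonal_def)
  then have quadratic: "(norm (C *v y))\<^sup>2 = (\<Sum>j\<in>UNIV. (norm (column j C))\<^sup>2 * (y $ j)\<^sup>2)"
    by (simp add: power_mult_distrib mult.commute)
  have "f \<bullet> (C *v y) = (transpose C *v f) \<bullet> y"
    by (simp add: dot_lmul_matrix)
  then have linear: "f \<bullet> (C *v y) = (\<Sum>j\<in>UNIV. (transpose C *v f) $ j * y $ j)"
    by (simp add: inner_vec_def)
  have "(norm (f - C *v y))\<^sup>2 = (norm f)\<^sup>2 + (norm (C *v y))\<^sup>2 - 2 * (f \<bullet> (C *v y))"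
    by (simp add: power2_norm_eq_inner algebra_simps inner_commute)
  then show ?thesis
    unfolding quadratic linear by (simp add: sum_subtractf sum_distrib_left mult.assoc)
qed

lemma convex_parabola_le_endpoint:
  fixes a b t d :: real
  assumes "a \<ge> 0" and "\<bar>t\<bar> \<le> d"
  shows "a * t\<^sup>2 - 2 * b * t \<le> a * d\<^sup>2 + 2 * d * \<bar>b\<bar>"
proof -
  have "t\<^sup>2 \<le> d\<^sup>2"
    using assms(2) by (simp add: abs_le_square_iff[symmetric])
  then have "a * t\<^sup>2 \<le> a * d\<^sup>2"
    using assms(1) by (rule mult_left_mono)
  moreover have "- (b * t) \<le> \<bar>b\<bar> * \<bar>t\<bar>"
    by (metis abs_ge_minus_self abs_mult)
  moreover have "\<bar>b\<bar> * \<bar>t\<bar> \<le> \<bar>b\<bar> * d"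
    using assms(2) by (intro mult_left_mono) auto
  ultimately show ?thesis
    by (simp add: mult.commute mult.left_commute)
qed

text \<open>
  The bound holds summand by summand, and one vertex of the cube attains all of these bounds
  simultaneously, because the sign of each coordinate can be chosen independently of the others.
\<close>

lemma maximum_residual_orthogonal_columns:
  fixes C :: "real ^ 'r ^ 'm" and f :: "real ^ 'm"
  assumes orth: "\<And>i j. i \<noteq> j \<Longrightarrow> orthogonal (column i C) (column j C)"
    and "d \<ge> 0"
  shows "is_maximum_on (\<lambda>y. (norm (f - C *v y))\<^sup>2) {y. infnorm y \<le> d}
           ((norm f)\<^sup>2 + 2 * d * l1_norm (transpose C *v f) + (frobenius_norm C)\<^sup>2 * d\<^sup>2)"
proof -
  define g where "g = transpose C *v f"
  define c where "c j = (norm (column j C))\<^sup>2" for j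
  have residual: "(norm (f - C *v y))\<^sup>2 =
      (norm f)\<^sup>2 + (\<Sum>j\<in>UNIV. c j * (y $ j)\<^sup>2 - 2 * g $ j * y $ j)" for y
    unfolding c_def g_def by (rule norm_residual_squared_separable[OF orth])
  have M: "(norm f)\<^sup>2 + 2 * d * l1_norm g + (frobenius_norm C)\<^sup>2 * d\<^sup>2 =
      (norm f)\<^sup>2 + (\<Sum>j\<in>UNIV. c j * d\<^sup>2 + 2 * d * \<bar>g $ j\<bar>)"
    by (simp add: frobenius_norm_squared_columns l1_norm_def c_def sum.distrib
        sum_distrib_left sum_distrib_right)
  \<comment> \<open>The library function \<open>sgn\<close> would give the value 0 where \<open>g $ j = 0\<close>; there an endpoint
    must still be chosen, as a positive quadratic term is maximal only at \<open>\<plusminus> d\<close>.\<close>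
  define y :: "real ^ 'r" where "y = (\<chi> j. if g $ j \<ge> 0 then - d else d)"
  have "infnorm y \<le> d"
    using \<open>d \<ge> 0\<close> by (simp add: infnorm_le_iff_components y_def)
  moreover have "c j * (y $ j)\<^sup>2 - 2 * g $ j * y $ j = c j * d\<^sup>2 + 2 * d * \<bar>g $ j\<bar>" for j
    by (simp add: y_def)
  ultimately have attained: "\<exists>y\<in>{y. infnorm y \<le> d}. (norm (f - C *v y))\<^sup>2 =
      (norm f)\<^sup>2 + (\<Sum>j\<in>UNIV. c j * d\<^sup>2 + 2 * d * \<bar>g $ j\<bar>)"
    by (intro bexI[of _ y]) (simp_all add: residual)
  have bound: "(norm (f - C *v y))\<^sup>2 \<le> (norm f)\<^sup>2 + (\<Sum>j\<in>UNIV. c j * d\<^sup>2 + 2 * d * \<bar>g $ j\<bar>)"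
    if "infnorm y \<le> d" for y
    unfolding residual using that
    by (intro add_left_mono sum_mono convex_parabola_le_endpoint)
      (simp_all add: infnorm_le_iff_components c_def)
  show ?thesis
    unfolding is_maximum_on_def g_def[symmetric] M using attained bound by blast
qed

theorem theorem2p1:
  fixes F :: "real ^ 'n \<Rightarrow> real ^ 'm"
    and \<delta> :: real
    and C :: "real ^ 'r ^ 'm"
    and Q :: "real ^ 'r ^ 'm"
    and R :: "real ^ 'r ^ 'r"
    and \<Omega> :: "(real ^ 'r) set"
  assumes "continuous_on UNIV F"
    and "\<delta> \<ge> 0"
    and "CARD('r) \<le> CARD('m)"
    and "rank C = CARD('r)"
    and "C = Q ** R"
    and "orthonormal_columns Q"
    and "diagonal_matrix R"
    and "\<forall>i. R $ i $ i > 0"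
    and "\<Omega> = {y. infnorm y \<le> \<delta>}"
  shows "\<forall>x. is_maximum_on (\<lambda>y. (norm (F x - C *v y))\<^sup>2) \<Omega>
           ((norm (F x))\<^sup>2 + 2 * \<delta> * l1_norm (transpose C *v F x)
              + (frobenius_norm C)\<^sup>2 * \<delta>\<^sup>2)"
  unfolding \<open>\<Omega> = {y. infnorm y \<le> \<delta>}\<close>
proof (intro allI maximum_residual_orthogonal_columns)
  show "orthogonal (column i C) (column j C)" if "i \<noteq> j" for i j
    unfolding \<open>C = Q ** R\<close>
    using orthogonal_columns_mult_diagonal[OF \<open>orthonormal_columns Q\<close> \<open>diagonal_matrix R\<close> that] .
qed (rule \<open>\<delta> \<ge> 0\<close>)

end
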